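(* Let $s$ be an odd prime, $p=1$, $q\ge2$ and $n=p+q+1$. Then the following $(p+q)\times n$ matrix over $\mathrm{GF}(s)$, whose first row is $\mathcal{G}_c$ and whose last $q$ rows form $\mathcal{G}_r$, yields a 2fi-optimal $s^{n-1}$ fractional factorial row-column design (in an $s^p\times s^q$ array): $$\mathcal{G}=\left(\begin{array}{ccc} 1 & \boldsymbol{1}_q^T & 2\\ \hline \boldsymbol{1}_q & I_q+J_q & \boldsymbol{1}_q\end{array}\right).$$
   Context: Matrices. $s$ is a prime and all matrices have entries in $\mathrm{GF}(s)=\mathbb{Z}/s$ (integers are reduced mod $s$). $I_v$ is the $v\times v$ identity, $J_v$ the $v\times v$ all-ones matrix, $\boldsymbol{1}_v$ the $v\times1$ all-ones vector. Designs. Let $p,q\ge1$, $p+q\le n$. An array generator matrix is a $(p+q)\times n$ matrix $\mathcal{G}$ over $\mathrm{GF}(s)$ of full row rank $p+q$; $\mathcal{G}_c$ denotes its first $p$ rows, $\mathcal{G}_r$ its last $q$ rows, and $\mathcal{G}_i,\mathcal{G}_{c,i},\mathcal{G}_{r,i}$ the $i$-th columns of $\mathcal{G},\mathcal{G}_c,\mathcal{G}_r$. If $\boldsymbol{x}_1,\dots,\boldsymbol{x}_{s^p}$ are the vectors of the row space of $\mathcal{G}_c$ and $\boldsymbol{y}_1,\dots,\boldsymbol{y}_{s^q}$ those of the row space of $\mathcal{G}_r$ (with $\boldsymbol{x}_1=\boldsymbol{y}_1=0$), $\mathcal{G}$ yields the $s^p\times s^q$ row-column design whose cell $(i,j)$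 carries the level combination $d[i,j]=\boldsymbol{x}_i+\boldsymbol{y}_j\in\mathrm{GF}(s)^n$ of the $n$ factors $F_1,\dots,F_n$. It is an $s^n$ full factorial design when $p+q=n$, and an $s^{n-k}$ fractional factorial design when $p+q=n-k<n$. Model and confounding. $Y_{ij}=\mu+\tau_i+\rho_j+\gamma_{d[i,j]}+\varepsilon_{ij}$, with row effects $\tau_i$, column effects $\rho_j$, uncorrelated mean-zero errors of variance $\sigma^2$, and $\gamma_{(x_1,\dots,x_n)}=\sum_l\alpha_{l,x_l}+\sum_{l<m}\sum_{v=1}^{s-1}\beta^{(v)}_{lm,\,x_l+vx_m}$, where $\sum_u\alpha_{l,u}=0$ and $\sum_u\beta^{(v)}_{lm,u}=0$. A main effect $F_l$ is unconfounded if the estimators of the $\alpha_{l,u}$ are uncorrelated with all other estimators in the model; the two-factor interaction (2fi) $F_l\times F_m$ is unconfounded if for every $v=1,\dots,s-1$ the estimators of the $\beta^{(v)}_{lm,u}$ are uncorrelated with all other estimators in the model. Interactions of three or more factors are assumed negligible. Equivalent algebraic criterion (known result, Zhou and Zhou 2023), usable as the definition of confounding. A main effect or 2fi is confounded with another main effect or 2fi iff the columns of $\mathcal{G}$ corresponding to the (distinct) factors involved in the two effects are linearly dependent. If $\mathcal{G}_i\ne0$, $F_i$ is confounded with column effects iff $\mathcal{G}_{c,i}=0$, and with row effects iff $\mathcal{G}_{r,i}=0$. If $\mathcal{G}_i,\mathcal{G}_j$ are linearly independent, $F_i\times F_j$ is confounded with column effects iff $\mathcal{G}_{c,i},\mathcal{G}_{c,j}$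 are linearly dependent, and with row effects iff $\mathcal{G}_{r,i},\mathcal{G}_{r,j}$ are linearly dependent. An effect is unconfounded iff none of these confoundings occurs. 2fi-optimality. The design yielded by $\mathcal{G}$ is 2fi-optimal if all main effects are unconfounded and the number of unconfounded 2fi's is maximum among all designs yielded by array generator matrices with the same $(s,p,q,n)$ for which all main effects are unconfounded. *)

theory Defs
  imports
    "Berlekamp_Zassenhaus.Finite_Field"
    "Jordan_Normal_Form.DL_Rank"
begin

text \<open>
  The field with \<open>s\<close> elements is \<open>'s mod_ring\<close>, with \<open>'s :: prime_card\<close> and \<open>s = CARD('s)\<close>.
  The factors, the rows and the columns of an array are numbered from 0: factor \<open>i\<close> belongs to
  column \<open>i\<close> of the generator matrix.
\<close>

subsection \<open>Array generator matrices and the designs they yield\<close>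

definition upper_rows :: "nat \<Rightarrow> 'a mat \<Rightarrow> 'a mat" where
  "upper_rows p G = mat p (dim_col G) (\<lambda>(i, j). G $$ (i, j))"

definition lower_rows :: "nat \<Rightarrow> 'a mat \<Rightarrow> 'a mat" where
  "lower_rows p G = mat (dim_row G - p) (dim_col G) (\<lambda>(i, j). G $$ (p + i, j))"

definition array_generator :: "nat \<Rightarrow> nat \<Rightarrow> nat \<Rightarrow> 's::prime_card mod_ring mat \<Rightarrow> bool" where
  "array_generator p q n G \<longleftrightarrow>
     1 \<le> p \<and> 1 \<le> q \<and> p + q \<le> n \<and> G \<in> carrier_mat (p + q) n \<and>
     vec_space.rank (p + q) G = p + q"

text \<open>
  The enumerations \<open>x\<close> and \<open>y\<close> of the two row spaces are arbitrary apart from their first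
  element, so \<open>G\<close> yields a design up to a permutation of the rows and columns of the array.
\<close>

definition yields_design ::
  "nat \<Rightarrow> nat \<Rightarrow> nat \<Rightarrow> 's::prime_card mod_ring mat \<Rightarrow> (nat \<Rightarrow> nat \<Rightarrow> 's mod_ring vec) \<Rightarrow> bool" where
  "yields_design p q n G d \<longleftrightarrow>
     (\<exists>x y. bij_betw x {..<CARD('s) ^ p} (vec_space.row_space n (upper_rows p G)) \<and>
            bij_betw y {..<CARD('s) ^ q} (vec_space.row_space n (lower_rows p G)) \<and>
            x 0 = 0\<^sub>v n \<and> y 0 = 0\<^sub>v n \<and>
            (\<forall>i < CARD('s) ^ p. \<forall>j < CARD('s) ^ q. d i j = x i + y j))"

definition yields_fractional_factorial ::
  "nat \<Rightarrow> nat \<Rightarrow> nat \<Rightarrow> nat \<Rightarrow> 's::prime_card mod_ring mat \<Rightarrow> bool" where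
  "yields_fractional_factorial p q n k G \<longleftrightarrow>
     array_generator p q n G \<and> p + q = n - k \<and> n - k < n \<and> (\<exists>d. yields_design p q n G d)"

subsection \<open>Effects and confounding\<close>

text \<open>
  The columns with index in \<open>S\<close> are taken as a family, so that two equal columns with different
  indices are dependent. (The library's \<open>lin_dep\<close> would identify them.)
\<close>

definition dependent_columns :: "'a::field mat \<Rightarrow> nat set \<Rightarrow> bool" where
  "dependent_columns M S \<longleftrightarrow>
     (\<exists>c. (\<exists>i\<in>S. c i \<noteq> 0) \<and> (\<forall>r < dim_row M. (\<Sum>i\<in>S. c i * M $$ (r, i)) = 0))"

lemma dependent_columns_singleton:
  assumes "i < dim_col M"
  shows "dependent_columns M {i} \<longleftrightarrow> col M i = 0\<^sub>v (dim_row M)"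
proof
  assume "dependent_columns M {i}"
  then show "col M i = 0\<^sub>v (dim_row M)"
    using assms by (auto simp: dependent_columns_def intro!: eq_vecI)
next
  assume col: "col M i = 0\<^sub>v (dim_row M)"
  have "M $$ (r, i) = 0" if "r < dim_row M" for r
  proof -
    have "M $$ (r, i) = col M i $ r" using assms that by simp
    then show ?thesis using that by (simp add: col)
  qed
  then show "dependent_columns M {i}"
    unfolding dependent_columns_def by (intro exI[of _ "\<lambda>_. 1"]) simp
qed

text \<open>An effect is identified with the set of the factors it involves.\<close>

definition main_effects :: "nat \<Rightarrow> nat set set" where
  "main_effects n = {{i} | i. i < n}"

definition two_factor_interactions :: "nat \<Rightarrow> nat set set" where
  "two_factor_interactions n = {{i, j} | i j. i < n \<and> j < n \<and> i \<noteq> j}"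

definition confounded_effects :: "'s::prime_card mod_ring mat \<Rightarrow> nat set \<Rightarrow> nat set \<Rightarrow> bool" where
  "confounded_effects G E E' \<longleftrightarrow> dependent_columns G (E \<union> E')"

text \<open>
  The main effect of factor \<open>i\<close> is confounded with column effects iff column \<open>i\<close> of the upper
  block vanishes; by \<open>dependent_columns_singleton\<close> this is the case \<open>E = {i}\<close> below.
  The criteria for row and column effects are meant for an effect whose own columns in \<open>G\<close> are
  linearly independent. An effect whose own columns are dependent is already confounded with
  another main effect or interaction, so the extension to such effects has no influence on
  \<open>unconfounded\<close>.
\<close>

definition confounded_with_column_effects ::
  "nat \<Rightarrow> 's::prime_card mod_ring mat \<Rightarrow> nat set \<Rightarrow> bool" where
  "confounded_with_column_effects p G E \<longleftrightarrow> dependent_columns (upper_rows p G) E"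

definition confounded_with_row_effects ::
  "nat \<Rightarrow> 's::prime_card mod_ring mat \<Rightarrow> nat set \<Rightarrow> bool" where
  "confounded_with_row_effects p G E \<longleftrightarrow> dependent_columns (lower_rows p G) E"

definition unconfounded :: "nat \<Rightarrow> nat \<Rightarrow> 's::prime_card mod_ring mat \<Rightarrow> nat set \<Rightarrow> bool" where
  "unconfounded p n G E \<longleftrightarrow>
     (\<forall>E' \<in> main_effects n \<union> two_factor_interactions n.
        E' \<noteq> E \<longrightarrow> \<not> confounded_effects G E E') \<and>
     \<not> confounded_with_column_effects p G E \<and>
     \<not> confounded_with_row_effects p G E"

subsection \<open>Optimality\<close>

definition main_effects_unconfounded ::
  "nat \<Rightarrow> nat \<Rightarrow> 's::prime_card mod_ring mat \<Rightarrow> bool" where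
  "main_effects_unconfounded p n G \<longleftrightarrow> (\<forall>E \<in> main_effects n. unconfounded p n G E)"

definition num_unconfounded_2fi :: "nat \<Rightarrow> nat \<Rightarrow> 's::prime_card mod_ring mat \<Rightarrow> nat" where
  "num_unconfounded_2fi p n G = card {E \<in> two_factor_interactions n. unconfounded p n G E}"

definition two_fi_optimal ::
  "nat \<Rightarrow> nat \<Rightarrow> nat \<Rightarrow> 's::prime_card mod_ring mat \<Rightarrow> bool" where
  "two_fi_optimal p q n G \<longleftrightarrow>
     array_generator p q n G \<and> main_effects_unconfounded p n G \<and>
     (\<forall>G' :: 's mod_ring mat.
        array_generator p q n G' \<and> main_effects_unconfounded p n G' \<longrightarrow>
        num_unconfounded_2fi p n G' \<le> num_unconfounded_2fi p n G)"

subsection \<open>The generator matrix\<close>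

definition all_ones_mat :: "nat \<Rightarrow> 'a::one mat" where
  "all_ones_mat v = mat v v (\<lambda>_. 1)"

text \<open>The block matrix with first row \<open>(1, 1\<^sup>T, 2)\<close> above the blocks \<open>1\<close>, \<open>I + J\<close>, \<open>1\<close> with \<open>q\<close> rows.\<close>

definition generator_mat :: "nat \<Rightarrow> 's::prime_card mod_ring mat" where
  "generator_mat q = mat (1 + q) (q + 2) (\<lambda>(i, j).
     if i = 0 then (if j = q + 1 then 2 else 1)
     else if 1 \<le> j \<and> j \<le> q then (1\<^sub>m q + all_ones_mat q) $$ (i - 1, j - 1)
     else 1)"

end

theory Submission
  imports Defs "Berlekamp_Zassenhaus.Berlekamp_Type_Based"
begin

text \<open>
  When the upper block \<open>G\<^sub>c\<close> is a single row, any two of its entries are linearly dependent, so every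
  two-factor interaction is confounded with column effects, whatever the generator
  (\<open>num_unconfounded_2fi_single_row\<close>). The maximum in the definition of 2fi-optimality is therefore 0,
  and a design is 2fi-optimal as soon as its generator has full rank and leaves all main effects
  unconfounded.

  For the matrix at hand both properties rest on one observation: since \<open>1 = 1 + 0\<close> and
  \<open>2 = 1 + 1\<close>, each row is the all-ones row plus one unit vector, and the positions of these unit
  vectors, the pivots, run once through all columns except the first
  (\<open>generator_mat_entry\<close>, \<open>generator_mat_row_sum\<close>). Subtracting the first column from the
  others thus produces all unit vectors, which gives full rank. A vector \<open>c\<close> in the kernel satisfies
  \<open>c\<^bsub>pivot r\<^esub> = - \<Sum>c\<close> for every row \<open>r\<close>, so the kernel is the line through
  \<open>(-(q + 2), 1, \<dots>, 1)\<close> (\<open>generator_mat_kernel\<close>). This vector has at least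
  \<open>q + 1\<close> nonzero entries, and for \<open>q = 2\<close> it has 4, because \<open>-4 \<noteq> 0\<close> in odd characteristic.
  Hence any three columns are independent (\<open>generator_mat_independent_columns\<close>), which is what keeps
  a main effect apart from all other main effects and two-factor interactions. No entry of the matrix
  vanishes when \<open>s\<close> is odd, so main effects are not confounded with row or column effects either.
\<close>

section \<open>Full row rank and the size of row spaces\<close>

lemma (in vec_space) rank_eq_dim_iff_col_space:
  assumes A: "A \<in> carrier_mat n nc"
  shows "rank A = n \<longleftrightarrow> col_space A = carrier_vec n"
proof
  assume full: "rank A = n"
  have cols: "set (cols A) \<subseteq> carrier_vec n"
    using A cols_dim by blast
  obtain U where max: "maximal U (\<lambda>T. T \<subseteq> set (cols A) \<and> lin_indpt T)" and fin: "finite U"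
    using maximal_exists_superset[of "set (cols A)" "\<lambda>T. T \<subseteq> set (cols A) \<and> lin_indpt T" "{}"]
      finite_lin_indpt2[of "{}"]
    by auto
  have U: "U \<subseteq> set (cols A)" "lin_indpt U"
    using max unfolding maximal_def by auto
  have "card U = n"
    using rank_card_indpt[OF A max] full by simp
  then have "basis U"
    using dim_li_is_basis[OF fin_dim fin _ U(2)] U(1) cols by (simp add: dim_is_n)
  then have "carrier_vec n = span U"
    by (simp add: basis_def)
  also have "\<dots> \<subseteq> col_space A"
    unfolding col_space_def by (rule span_is_monotone[OF U(1)])
  finally show "col_space A = carrier_vec n"
    using span_closed[OF cols] unfolding col_space_def by auto
next
  assume "col_space A = carrier_vec n"
  then have "span_vs (set (cols A)) = V"
    by (simp add: col_space_def)
  then show "rank A = n"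
    unfolding rank_def by (simp add: dim_is_n)
qed

lemma full_rank_iff_surjective:
  fixes A :: "'a::field mat"
  assumes A: "A \<in> carrier_mat m n"
  shows "vec_space.rank m A = m \<longleftrightarrow> (\<forall>y\<in>carrier_vec m. \<exists>x\<in>carrier_vec n. A *\<^sub>v x = y)"
proof -
  interpret vec_space "TYPE('a)" m .
  show ?thesis
    using A unfolding rank_eq_dim_iff_col_space[OF A] col_space_eq[OF A] by auto
qed

text \<open>
  If \<open>x \<mapsto> A x\<close> is onto, its dual \<open>y \<mapsto> A\<^sup>T y\<close> is injective: the coordinate \<open>y\<^sub>i\<close> is recovered as
  \<open>y \<bullet> A x = A\<^sup>T y \<bullet> x\<close> from an \<open>x\<close> that \<open>A\<close> maps to the \<open>i\<close>-th unit vector. So the row space is in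
  bijection with the coefficient vectors \<open>y\<close>.
\<close>

lemma card_row_space:
  fixes A :: "'a::{field,finite} mat"
  assumes A: "A \<in> carrier_mat m n"
    and surj: "\<And>y. y \<in> carrier_vec m \<Longrightarrow> \<exists>x\<in>carrier_vec n. A *\<^sub>v x = y"
  shows "card (vec_space.row_space n A) = CARD('a) ^ m"
proof -
  interpret vec_space "TYPE('a)" n .
  have "row_space A = (\<lambda>y. A\<^sup>T *\<^sub>v y) ` carrier_vec m"
    using A unfolding row_space_eq[OF A] by auto
  moreover have "inj_on (\<lambda>y. A\<^sup>T *\<^sub>v y) (carrier_vec m)"
  proof (rule inj_onI)
    fix y z :: "'a vec"
    assume y: "y \<in> carrier_vec m" and z: "z \<in> carrier_vec m" and eq: "A\<^sup>T *\<^sub>v y = A\<^sup>T *\<^sub>v z"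
    show "y = z"
    proof (rule eq_vecI)
      fix i assume "i < dim_vec z"
      then have i: "i < m" using z by simp
      obtain x where x: "x \<in> carrier_vec n" "A *\<^sub>v x = unit_vec m i"
        using surj[of "unit_vec m i"] by auto
      have "y \<bullet> unit_vec m i = (A\<^sup>T *\<^sub>v y) \<bullet> x"
        using transpose_vec_mult_scalar[OF A x(1) y] x(2) by simp
      also have "\<dots> = z \<bullet> unit_vec m i"
        using transpose_vec_mult_scalar[OF A x(1) z] x(2) eq by simp
      finally show "y $ i = z $ i"
        using i y z by simp
    qed (use y z in simp)
  qed
  ultimately show ?thesis
    by (simp add: card_image card_carrier_vec)
qed

lemma row_space_enumeration:
  fixes A :: "'a::{field,finite} mat"
  assumes A: "A \<in> carrier_mat m n"
    and surj: "\<And>y. y \<in> carrier_vec m \<Longrightarrow> \<exists>x\<in>carrier_vec n. A *\<^sub>v x = y"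
  shows "\<exists>x. bij_betw x {..<CARD('a) ^ m} (vec_space.row_space n A) \<and> x 0 = 0\<^sub>v n"
proof -
  interpret vec_space "TYPE('a)" n .
  let ?N = "CARD('a) ^ m" and ?R = "row_space A"
  have card: "card ?R = ?N"
    by (rule card_row_space[OF A surj])
  have N: "0 < ?N" by simp
  then have fin: "finite ?R"
    using card card_ge_0_finite by metis
  have "A\<^sup>T *\<^sub>v 0\<^sub>v m = 0\<^sub>v n"
    using A by auto
  then have zero: "0\<^sub>v n \<in> ?R"
    using A unfolding row_space_eq[OF A] by auto
  have "card {1..<?N} = card (?R - {0\<^sub>v n})"
    using card zero fin by simp
  then obtain h where "bij_betw h {1..<?N} (?R - {0\<^sub>v n})"
    using finite_same_card_bij[of "{1..<?N}" "?R - {0\<^sub>v n}"] fin by auto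
  then have "bij_betw (h(0 := 0\<^sub>v n)) {1..<?N} (?R - {0\<^sub>v n})"
    by (subst bij_betw_cong[of _ _ h]) auto
  then have "bij_betw (h(0 := 0\<^sub>v n)) ({1..<?N} \<union> {0}) ((?R - {0\<^sub>v n}) \<union> {0\<^sub>v n})"
    using notIn_Un_bij_betw[of 0 "{1..<?N}" "h(0 := 0\<^sub>v n)" "?R - {0\<^sub>v n}"] by simp
  moreover have "{1..<?N} \<union> {0} = {..<?N}"
    using N by (auto simp: Suc_le_eq)
  moreover have "(?R - {0\<^sub>v n}) \<union> {0\<^sub>v n} = ?R"
    using zero by auto
  ultimately show ?thesis
    by (metis fun_upd_same)
qed

text \<open>
  Full rank passes from a matrix to each of its two row blocks: a preimage of a vector padded with
  zeros in the other block is a preimage for the block itself. Hence both row spaces have exactly as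
  many elements as the array has rows and columns.
\<close>

lemma array_generator_yields_design:
  fixes G :: "'s::prime_card mod_ring mat"
  assumes gen: "array_generator p q n G"
  shows "\<exists>d. yields_design p q n G d"
proof -
  have G: "G \<in> carrier_mat (p + q) n" and rank: "vec_space.rank (p + q) G = p + q"
    using gen by (auto simp: array_generator_def)
  have surj: "\<exists>x\<in>carrier_vec n. G *\<^sub>v x = y" if "y \<in> carrier_vec (p + q)" for y
    using rank that unfolding full_rank_iff_surjective[OF G] by blast
  have upper: "upper_rows p G \<in> carrier_mat p n" and lower: "lower_rows p G \<in> carrier_mat q n"
    using G by (auto simp: upper_rows_def lower_rows_def)
  have surj_upper: "\<exists>x\<in>carrier_vec n. upper_rows p G *\<^sub>v x = y"
    if y: "y \<in> carrier_vec p" for y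
  proof -
    obtain x where x: "x \<in> carrier_vec n" "G *\<^sub>v x = y @\<^sub>v 0\<^sub>v q"
      using surj[of "y @\<^sub>v 0\<^sub>v q"] y by auto
    have "upper_rows p G *\<^sub>v x = y"
    proof (rule eq_vecI)
      fix i assume "i < dim_vec y"
      then have i: "i < p" using y by simp
      have "(upper_rows p G *\<^sub>v x) $ i = (G *\<^sub>v x) $ i"
        using i G x(1) by (auto simp: upper_rows_def scalar_prod_def)
      then show "(upper_rows p G *\<^sub>v x) $ i = y $ i"
        using i y by (simp add: x(2))
    qed (use upper y in simp)
    with x(1) show ?thesis by blast
  qed
  have surj_lower: "\<exists>x\<in>carrier_vec n. lower_rows p G *\<^sub>v x = y"
    if y: "y \<in> carrier_vec q" for y
  proof -
    obtain x where x: "x \<in> carrier_vec n" "G *\<^sub>v x = 0\<^sub>v p @\<^sub>v y"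
      using surj[of "0\<^sub>v p @\<^sub>v y"] y by auto
    have "lower_rows p G *\<^sub>v x = y"
    proof (rule eq_vecI)
      fix i assume "i < dim_vec y"
      then have i: "i < q" using y by simp
      have "(lower_rows p G *\<^sub>v x) $ i = (G *\<^sub>v x) $ (p + i)"
        using i G x(1) by (auto simp: lower_rows_def scalar_prod_def)
      then show "(lower_rows p G *\<^sub>v x) $ i = y $ i"
        using i y by (simp add: x(2))
    qed (use lower y in simp)
    with x(1) show ?thesis by blast
  qed
  obtain x where "bij_betw x {..<CARD('s) ^ p} (vec_space.row_space n (upper_rows p G))"
      "x 0 = 0\<^sub>v n"
    using row_space_enumeration[OF upper surj_upper] by auto
  moreover obtain y where "bij_betw y {..<CARD('s) ^ q} (vec_space.row_space n (lower_rows p G))"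
      "y 0 = 0\<^sub>v n"
    using row_space_enumeration[OF lower surj_lower] by auto
  ultimately show ?thesis
    unfolding yields_design_def by (intro exI[of _ "\<lambda>i j. x i + y j"]) blast
qed

section \<open>Two-factor interactions in arrays with a one-row upper block\<close>

lemma dependent_columns_single_row:
  assumes "dim_row M = 1" and "i \<noteq> j"
  shows "dependent_columns M {i, j}"
proof (cases "M $$ (0, i) = 0 \<and> M $$ (0, j) = 0")
  case True
  then show ?thesis
    unfolding dependent_columns_def using assms by (intro exI[of _ "\<lambda>_. 1"]) auto
next
  case False
  then show ?thesis
    unfolding dependent_columns_def using assms
    by (intro exI[of _ "\<lambda>k. if k = i then M $$ (0, j) else - M $$ (0, i)"]) auto
qed

text \<open>This makes the comparison with the other designs in 2fi-optimality trivial for \<open>p = 1\<close>.\<close>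

lemma num_unconfounded_2fi_single_row:
  fixes G :: "'s::prime_card mod_ring mat"
  shows "num_unconfounded_2fi 1 n G = 0"
proof -
  have "\<not> unconfounded 1 n G E" if "E \<in> two_factor_interactions n" for E
    using that dependent_columns_single_row[of "upper_rows 1 G"]
    by (auto simp: two_factor_interactions_def unconfounded_def confounded_with_column_effects_def
        upper_rows_def)
  then have no: "{E \<in> two_factor_interactions n. unconfounded 1 n G E} = {}"
    by blast
  show ?thesis
    unfolding num_unconfounded_2fi_def no by simp
qed

section \<open>The columns of the generator matrix\<close>

text \<open>
  The column in which row \<open>r\<close> carries the entry 2 instead of 1: the corner of the first row, and the
  diagonal of \<open>I + J\<close> for the other rows.
\<close>

definition pivot :: "nat \<Rightarrow> nat \<Rightarrow> nat" where
  "pivot q r = (if r = 0 then q + 1 else r)"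

lemma generator_mat_carrier:
  "(generator_mat q :: 's::prime_card mod_ring mat) \<in> carrier_mat (1 + q) (q + 2)"
  by (simp add: generator_mat_def)

lemma generator_mat_entry:
  assumes "r < 1 + q" and "j < q + 2"
  shows "(generator_mat q :: 's::prime_card mod_ring mat) $$ (r, j) =
    1 + (if j = pivot q r then 1 else 0)"
  using assms by (auto simp: generator_mat_def all_ones_mat_def pivot_def)

lemma generator_mat_row_sum:
  fixes c :: "nat \<Rightarrow> 's::prime_card mod_ring"
  assumes r: "r < 1 + q"
  shows "(\<Sum>j<q + 2. c j * generator_mat q $$ (r, j)) = (\<Sum>j<q + 2. c j) + c (pivot q r)"
proof -
  have "(\<Sum>j<q + 2. c j * generator_mat q $$ (r, j)) =
      (\<Sum>j<q + 2. c j + (if j = pivot q r then c j else 0))"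
    using r by (intro sum.cong) (auto simp: generator_mat_entry distrib_left)
  also have "\<dots> = (\<Sum>j<q + 2. c j) + c (pivot q r)"
    using r by (simp add: sum.distrib pivot_def del: sum.lessThan_Suc)
  finally show ?thesis .
qed

text \<open>
  All kernel equations have the form \<open>c\<^bsub>pivot r\<^esub> = - T\<close> with the same total \<open>T = \<Sum>c\<close>, so \<open>c\<close> is
  constant on the pivots, and evaluating \<open>T\<close> then fixes the remaining coordinate \<open>c\<^sub>0\<close>.
\<close>

lemma generator_mat_kernel:
  fixes c :: "nat \<Rightarrow> 's::prime_card mod_ring"
  assumes ker: "\<And>r. r < 1 + q \<Longrightarrow> (\<Sum>j<q + 2. c j * generator_mat q $$ (r, j)) = 0"
  shows "\<And>j. 1 \<le> j \<Longrightarrow> j \<le> q + 1 \<Longrightarrow> c j = c (q + 1)"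
    and "c 0 = - of_nat (q + 2) * c (q + 1)"
proof -
  let ?T = "\<Sum>j<q + 2. c j"
  have eq: "c (pivot q r) = - ?T" if "r < 1 + q" for r
    using ker[OF that] generator_mat_row_sum[OF that, of c]
    by (metis add.commute eq_neg_iff_add_eq_0)
  have all: "c j = - ?T" if "1 \<le> j" "j \<le> q + 1" for j
  proof (cases "j = q + 1")
    case True
    then show ?thesis using eq[of 0] by (simp add: pivot_def del: sum.lessThan_Suc)
  next
    case False
    then show ?thesis using eq[of j] that by (simp add: pivot_def del: sum.lessThan_Suc)
  qed
  have last: "c (q + 1) = - ?T"
    by (rule all) auto
  show const: "c j = c (q + 1)" if "1 \<le> j" "j \<le> q + 1" for j
    by (rule trans[OF all[OF that] last[symmetric]])
  have "?T = c 0 + (\<Sum>j<q + 1. c (Suc j))"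
    by (metis add_Suc_right one_add_one plus_1_eq_Suc sum.lessThan_Suc_shift add.commute)
  also have "(\<Sum>j<q + 1. c (Suc j)) = (\<Sum>j<q + 1. c (q + 1))"
    by (intro sum.cong const) auto
  finally have "?T = c 0 + of_nat (q + 1) * c (q + 1)"
    by simp
  with last have "c (q + 1) = - (c 0 + of_nat (q + 1) * c (q + 1))"
    by (rule trans[OF _ arg_cong[where f = uminus]])
  then have "c 0 + of_nat (q + 1) * c (q + 1) = - c (q + 1)"
    by (metis minus_minus)
  then have "c 0 = - c (q + 1) - of_nat (q + 1) * c (q + 1)"
    by (metis add_diff_cancel_right')
  then show "c 0 = - of_nat (q + 2) * c (q + 1)"
    by (simp add: algebra_simps)
qed

lemma two_neq_zero_mod_ring:
  assumes "odd CARD('s)"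
  shows "(2 :: 's::prime_card mod_ring) \<noteq> 0"
proof
  assume "(2 :: 's mod_ring) = 0"
  then have "of_nat 2 = (0 :: 's mod_ring)" by simp
  then have "CARD('s) dvd 2"
    by (rule of_nat_0_mod_ring_dvd)
  then show False
    using assms prime_card[where 'a = 's] by (metis dvd_refl prime_nat_iff primes_dvd_imp_eq two_is_prime_nat)
qed

lemma generator_mat_full_rank:
  "vec_space.rank (1 + q) (generator_mat q :: 's::prime_card mod_ring mat) = 1 + q"
proof -
  let ?G = "generator_mat q :: 's mod_ring mat"
  have "\<exists>x\<in>carrier_vec (q + 2). ?G *\<^sub>v x = y" if y: "y \<in> carrier_vec (1 + q)" for y
  proof -
    \<comment> \<open>Copy \<open>y\<close> to the pivot columns and choose the free coordinate so that the all-ones part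
        of each row contributes 0.\<close>
    define c where "c j = (if j = 0 then - (\<Sum>i<1 + q. y $ i) else if j = q + 1 then y $ 0 else y $ j)"
      for j
    have "(\<Sum>j<q + 2. c j) = c 0 + (\<Sum>j<q. c (Suc j)) + c (q + 1)"
      using sum.lessThan_Suc_shift[of c q] by (simp add: add_ac)
    also have "(\<Sum>j<q. c (Suc j)) = (\<Sum>j<q. y $ Suc j)"
      by (intro sum.cong) (auto simp: c_def)
    also have "c 0 = - (y $ 0 + (\<Sum>j<q. y $ Suc j))"
      by (simp add: c_def sum.lessThan_Suc_shift del: sum.lessThan_Suc)
    also have "c (q + 1) = y $ 0"
      by (simp add: c_def)
    finally have T: "(\<Sum>j<q + 2. c j) = 0"
      by simp
    have "?G *\<^sub>v vec (q + 2) c = y"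
    proof (rule eq_vecI)
      fix r assume "r < dim_vec y"
      then have r: "r < 1 + q" using y by simp
      have "(?G *\<^sub>v vec (q + 2) c) $ r = (\<Sum>j<q + 2. c j * ?G $$ (r, j))"
        using r generator_mat_carrier[of q, where 's = 's]
        by (auto simp: scalar_prod_def lessThan_atLeast0 mult.commute simp del: sum.op_ivl_Suc intro!: sum.cong)
      also have "\<dots> = y $ r"
        using r by (simp only: generator_mat_row_sum T) (auto simp: c_def pivot_def)
      finally show "(?G *\<^sub>v vec (q + 2) c) $ r = y $ r" .
    qed (use y generator_mat_carrier[of q, where 's = 's] in simp)
    then show ?thesis
      by (intro bexI[of _ "vec (q + 2) c"]) auto
  qed
  then show ?thesis
    using full_rank_iff_surjective[OF generator_mat_carrier[of q, where 's = 's]] by blast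
qed

text \<open>
  A dependency supported on \<open>S\<close> is a kernel vector that vanishes outside \<open>S\<close>. If \<open>S\<close> misses a pivot
  column, the constant value on the pivots is 0. A set of at most three columns can contain all
  \<open>q + 1\<close> pivots only if \<open>q = 2\<close>, and then it misses column 0, which forces \<open>4\<close> times that value to
  vanish.
\<close>

lemma generator_mat_independent_columns:
  fixes S :: "nat set"
  assumes odd: "odd CARD('s::prime_card)" and q: "q \<ge> 2"
    and S: "S \<subseteq> {..<q + 2}" and card: "card S \<le> 3"
  shows "\<not> dependent_columns (generator_mat q :: 's mod_ring mat) S"
proof
  let ?G = "generator_mat q :: 's mod_ring mat"
  assume "dependent_columns ?G S"
  then obtain b i where i: "i \<in> S" "b i \<noteq> 0"
    and b: "\<And>r. r < 1 + q \<Longrightarrow> (\<Sum>j\<in>S. b j * ?G $$ (r, j)) = 0"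
    using generator_mat_carrier[of q, where 's = 's] unfolding dependent_columns_def by auto
  \<comment> \<open>Extending the coefficients by 0 turns the dependency into a vector in the kernel.\<close>
  define c where "c j = (if j \<in> S then b j else 0)" for j
  have ker: "(\<Sum>j<q + 2. c j * ?G $$ (r, j)) = 0" if "r < 1 + q" for r
  proof -
    have "(\<Sum>j<q + 2. c j * ?G $$ (r, j)) = (\<Sum>j\<in>S. b j * ?G $$ (r, j))"
      using S by (intro sum.mono_neutral_cong_right) (auto simp: c_def)
    then show ?thesis using b[OF that] by simp
  qed
  note const = generator_mat_kernel(1)[OF ker] and c0 = generator_mat_kernel(2)[OF ker]
  have "c (q + 1) = 0"
  proof (cases "{1..q + 1} \<subseteq> S")
    case False
    then obtain j where "j \<in> {1..q + 1}" "j \<notin> S" by blast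
    then show ?thesis
      using const[of j] by (simp add: c_def)
  next
    case True
    have fin: "finite S"
      using S finite_subset by blast
    have "card {1..q + 1} \<le> card S"
      by (rule card_mono[OF fin True])
    then have q2: "q = 2"
      using card q by simp
    have "0 \<notin> S"
    proof
      assume "0 \<in> S"
      then have "card (insert 0 {1..q + 1}) \<le> card S"
        using True by (intro card_mono[OF fin]) auto
      then show False
        using card q by simp
    qed
    then have "2 * (2 * c (q + 1)) = 0"
      using c0 by (simp add: c_def q2)
    then show ?thesis
      using two_neq_zero_mod_ring[OF odd] by (metis mult_eq_0_iff)
  qed
  then have "c i = 0"
    using const[of i] c0 i S by (cases "i = 0") auto
  then show False
    using i by (simp add: c_def)
qed

lemma generator_mat_main_effects_unconfounded:
  assumes odd: "odd CARD('s::prime_card)" and q: "q \<ge> 2"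
  shows "main_effects_unconfounded 1 (q + 2) (generator_mat q :: 's mod_ring mat)"
proof -
  let ?G = "generator_mat q :: 's mod_ring mat"
  note two = two_neq_zero_mod_ring[OF odd]
  have nonzero: "?G $$ (r, i) \<noteq> 0" if "r < 1 + q" "i < q + 2" for r i
    using that two by (simp add: generator_mat_entry)
  have "unconfounded 1 (q + 2) ?G {i}" if i: "i < q + 2" for i
    unfolding unconfounded_def
  proof (intro conjI ballI impI)
    fix E assume "E \<in> main_effects (q + 2) \<union> two_factor_interactions (q + 2)"
    \<comment> \<open>A main effect is covered by \<open>j = k\<close>.\<close>
    then obtain j k where "E = {j, k}" "j < q + 2" "k < q + 2"
      by (auto simp: main_effects_def two_factor_interactions_def)
    then have "{i} \<union> E \<subseteq> {..<q + 2}" "card ({i} \<union> E) \<le> 3"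
      using i by (auto simp: card_insert_if)
    then show "\<not> confounded_effects ?G {i} E"
      unfolding confounded_effects_def by (rule generator_mat_independent_columns[OF odd q])
  next
    show "\<not> confounded_with_column_effects 1 ?G {i}"
      using nonzero[of 0 i] i
      by (auto simp: confounded_with_column_effects_def dependent_columns_def upper_rows_def
          generator_mat_def)
  next
    show "\<not> confounded_with_row_effects 1 ?G {i}"
    proof
      assume "confounded_with_row_effects 1 ?G {i}"
      then obtain b where "b \<noteq> 0" "\<forall>r<q. b * ?G $$ (Suc r, i) = 0"
        using i by (auto simp: confounded_with_row_effects_def dependent_columns_def lower_rows_def
            generator_mat_def)
      then show False
        using nonzero[of "Suc 0" i] i q by auto
    qed
  qed
  then show ?thesis
    by (auto simp: main_effects_unconfounded_def main_effects_def)
qed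

theorem theorem9:
  fixes p q n :: nat and G :: "'s::prime_card mod_ring mat"
  assumes "odd CARD('s)"
    and "p = 1" and "q \<ge> 2" and "n = p + q + 1"
    and "G = generator_mat q"
  shows "yields_fractional_factorial p q n 1 G \<and> two_fi_optimal p q n G"
proof -
  have n: "n = q + 2"
    using assms by simp
  have gen: "array_generator p q n G"
    using assms generator_mat_carrier[of q, where 's = 's] generator_mat_full_rank[of q, where 's = 's]
    by (simp add: array_generator_def)
  have main: "main_effects_unconfounded p n G"
    using generator_mat_main_effects_unconfounded[where 's = 's, of q] assms n by simp
  have "yields_fractional_factorial p q n 1 G"
    using gen array_generator_yields_design[OF gen] assms
    by (simp add: yields_fractional_factorial_def)
  moreover have "two_fi_optimal p q n G"
    using gen main assms(2)
    by (simp add: two_fi_optimal_def num_unconfounded_2fi_single_row del: One_nat_def)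
  ultimately show ?thesis ..
qed

end
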